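(* For any Description Logic $\mathcal{L}$, both GA-entailment and IGA-entailment fail to satisfy the indistinguishability property for $\mathcal{L}$ and the class of all policies (finite sets of arbitrary epistemic dependencies).
   Context: Signature: predicates are unary (concept names) or binary (role names); $\Sigma_I$ is a countably infinite set of constants. A fact is a ground atom. An ABox is a set of facts; a TBox of a Description Logic (DL) $\mathcal{L}$ is a set of axioms of $\mathcal{L}$, viewed as first-order (FO) sentences over these predicates (the empty set is a TBox of every DL). $\models$ is FO entailment. A conjunctive query (CQ) is $\exists\vec{x}\,\phi$ with $\phi$ a conjunction of atoms (constants allowed); the special ground CQ $\bot$, false in every interpretation, is also allowed. A Boolean union of CQs (BUCQ) is a disjunction of CQs without free variables. Epistemic dependency (ED): $\tau=\forall\vec{x}_1,\vec{x}_2\,(K q_b(\vec{x}_1,\vec{x}_2)\to K q_h(\vec{x}_2))$, where $q_b,q_h$ are CQs with the displayed free variables; $\mathsf{body}(\tau)=q_b$, $\mathsf{head}(\tau)=q_h$. A ground substitution $\sigma$ for $\tau$ maps its universally quantified variables to constants; $\sigma(\tau)$ is the resulting instance. An FO theory $\Phi$ satisfies $\tau$ if for every ground substitution $\sigma$ for $\tau$, $\Phi\models\mathsf{body}(\sigma(\tau))$ implies $\Phi\models\mathsf{head}(\sigma(\tau))$. A policy is a finite set of EDs; $\Phi$ satisfies it if it satisfies all its EDs. An $\mathcal{L}$ CQE instance is $\mathcal{E}=\langle\mathcal{T},\mathcal{P},\mathcal{A}\rangle$ with $\mathcal{T}$ an $\mathcal{L}$ TBox, $\mathcal{P}$ a policy,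 $\mathcal{A}$ an ABox, and $\mathcal{T}\cup\mathcal{A}$ consistent. $\mathsf{cl}_{\mathcal{T}}(\mathcal{A})$ is the set of facts $\alpha$ with $\mathcal{T}\cup\mathcal{A}\models\alpha$. A GA censor of $\mathcal{E}$ is a set $\mathcal{C}\subseteq\mathsf{cl}_{\mathcal{T}}(\mathcal{A})$ such that $\mathcal{T}\cup\mathcal{C}$ satisfies $\mathcal{P}$; it is optimal if no proper superset of it is a GA censor of $\mathcal{E}$. $\mathcal{E}$ GA-entails $q$ if $\mathcal{T}\cup\mathcal{C}\models q$ for every optimal GA censor $\mathcal{C}$ of $\mathcal{E}$; $\mathcal{E}$ IGA-entails $q$ if $\mathcal{T}\cup\mathcal{C}^{\mathcal{E}}_{\mathsf{IGA}}\models q$, where $\mathcal{C}^{\mathcal{E}}_{\mathsf{IGA}}$ is the intersection of all optimal GA censors of $\mathcal{E}$. Indistinguishability: a CQE entailment relation $\models_\Diamond$ satisfies the indistinguishability property for a DL $\mathcal{L}$ and a class $C_p$ of policies if for every $\mathcal{L}$ CQE instance $\mathcal{E}=\langle\mathcal{T},\mathcal{P},\mathcal{A}\rangle$ with $\mathcal{P}\in C_p$ there is a CQE instance $\mathcal{E}'=\langle\mathcal{T},\mathcal{P},\mathcal{A}'\rangle$ such that $\mathcal{T}\cup\mathcal{A}'$ satisfies $\mathcal{P}$ and, for every BUCQ $q$, $\mathcal{E}\models_\Diamond q$ iff $\mathcal{E}'\models_\Diamond q$. *)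

theory Defs
  imports "HOL-Library.Countable_Set"
begin

datatype 'i trm = Var nat | Const 'i

datatype ('c, 'r, 'i) fm =
    Fls
  | Conc 'c "'i trm"
  | Role 'r "'i trm" "'i trm"
  | Eq "'i trm" "'i trm"
  | Neg "('c, 'r, 'i) fm"
  | Conj "('c, 'r, 'i) fm" "('c, 'r, 'i) fm"
  | Disj "('c, 'r, 'i) fm" "('c, 'r, 'i) fm"
  | Ex nat "('c, 'r, 'i) fm"
  | All nat "('c, 'r, 'i) fm"

primrec fv_trm :: "'i trm \<Rightarrow> nat set" where
  "fv_trm (Var x) = {x}"
| "fv_trm (Const a) = {}"

primrec fv :: "('c, 'r, 'i) fm \<Rightarrow> nat set" where
  "fv Fls = {}"
| "fv (Conc A t) = fv_trm t"
| "fv (Role R t u) = fv_trm t \<union> fv_trm u"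
| "fv (Eq t u) = fv_trm t \<union> fv_trm u"
| "fv (Neg p) = fv p"
| "fv (Conj p q) = fv p \<union> fv q"
| "fv (Disj p q) = fv p \<union> fv q"
| "fv (Ex x p) = fv p - {x}"
| "fv (All x p) = fv p - {x}"

definition sentence :: "('c, 'r, 'i) fm \<Rightarrow> bool" where
  "sentence p \<longleftrightarrow> fv p = {}"

primrec subst_trm :: "(nat \<rightharpoonup> 'i) \<Rightarrow> 'i trm \<Rightarrow> 'i trm" where
  "subst_trm s (Var x) = (case s x of None \<Rightarrow> Var x | Some a \<Rightarrow> Const a)"
| "subst_trm s (Const a) = Const a"

primrec subst :: "(nat \<rightharpoonup> 'i) \<Rightarrow> ('c, 'r, 'i) fm \<Rightarrow> ('c, 'r, 'i) fm" where
  "subst s Fls = Fls"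
| "subst s (Conc A t) = Conc A (subst_trm s t)"
| "subst s (Role R t u) = Role R (subst_trm s t) (subst_trm s u)"
| "subst s (Eq t u) = Eq (subst_trm s t) (subst_trm s u)"
| "subst s (Neg p) = Neg (subst s p)"
| "subst s (Conj p q) = Conj (subst s p) (subst s q)"
| "subst s (Disj p q) = Disj (subst s p) (subst s q)"
| "subst s (Ex x p) = Ex x (subst (s(x := None)) p)"
| "subst s (All x p) = All x (subst (s(x := None)) p)"

record ('c, 'r, 'i, 'd) interp =
  univ :: "'d set"
  conc_ext :: "'c \<Rightarrow> 'd set"
  role_ext :: "'r \<Rightarrow> ('d \<times> 'd) set"
  const_val :: "'i \<Rightarrow> 'd"

definition is_interp :: "('c, 'r, 'i, 'd) interp \<Rightarrow> bool" where
  "is_interp I \<longleftrightarrow> univ I \<noteq> {} \<and> (\<forall>A. conc_ext I A \<subseteq> univ I)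
     \<and> (\<forall>R. role_ext I R \<subseteq> univ I \<times> univ I) \<and> (\<forall>a. const_val I a \<in> univ I)"

primrec trm_val :: "('c, 'r, 'i, 'd) interp \<Rightarrow> (nat \<Rightarrow> 'd) \<Rightarrow> 'i trm \<Rightarrow> 'd" where
  "trm_val I e (Var x) = e x"
| "trm_val I e (Const a) = const_val I a"

primrec sat :: "('c, 'r, 'i, 'd) interp \<Rightarrow> (nat \<Rightarrow> 'd) \<Rightarrow> ('c, 'r, 'i) fm \<Rightarrow> bool" where
  "sat I e Fls \<longleftrightarrow> False"
| "sat I e (Conc A t) \<longleftrightarrow> trm_val I e t \<in> conc_ext I A"
| "sat I e (Role R t u) \<longleftrightarrow> (trm_val I e t, trm_val I e u) \<in> role_ext I R"
| "sat I e (Eq t u) \<longleftrightarrow> trm_val I e t = trm_val I e u"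
| "sat I e (Neg p) \<longleftrightarrow> \<not> sat I e p"
| "sat I e (Conj p q) \<longleftrightarrow> sat I e p \<and> sat I e q"
| "sat I e (Disj p q) \<longleftrightarrow> sat I e p \<or> sat I e q"
| "sat I e (Ex x p) \<longleftrightarrow> (\<exists>d\<in>univ I. sat I (e(x := d)) p)"
| "sat I e (All x p) \<longleftrightarrow> (\<forall>d\<in>univ I. sat I (e(x := d)) p)"

definition models :: "('c, 'r, 'i, 'd) interp \<Rightarrow> ('c, 'r, 'i) fm set \<Rightarrow> bool" where
  "models I \<Phi> \<longleftrightarrow> (\<forall>p\<in>\<Phi>. \<forall>e. range e \<subseteq> univ I \<longrightarrow> sat I e p)"

text \<open>
  A definition cannot quantify over the type of domain elements. Consistency and entailment
  therefore range over all interpretations whose domain is a nonempty set of elements of a type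
  with as many elements as there are formulas, namely the type of formulas itself. By the downward
  Loewenheim-Skolem theorem this is no restriction: see the lemmas \<open>entails_any_domain\<close> and
  \<open>consistent_any_domain\<close> below, in which the domain type is arbitrary.
\<close>

type_synonym ('c, 'r, 'i) std_interp = "('c, 'r, 'i, ('c, 'r, 'i) fm) interp"

definition entails :: "('c, 'r, 'i) fm set \<Rightarrow> ('c, 'r, 'i) fm \<Rightarrow> bool" where
  "entails \<Phi> p \<longleftrightarrow>
     (\<forall>I :: ('c, 'r, 'i) std_interp. is_interp I \<longrightarrow> models I \<Phi> \<longrightarrow> models I {p})"

definition consistent :: "('c, 'r, 'i) fm set \<Rightarrow> bool" where
  "consistent \<Phi> \<longleftrightarrow> (\<exists>I :: ('c, 'r, 'i) std_interp. is_interp I \<and> models I \<Phi>)"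

lemma finite_fv_trm: "finite (fv_trm t)"
  by (cases t) auto

lemma finite_fv: "finite (fv p)"
  by (induction p) (auto simp: finite_fv_trm)

lemma trm_val_cong: "(\<And>x. x \<in> fv_trm t \<Longrightarrow> e x = e' x) \<Longrightarrow> trm_val I e t = trm_val I e' t"
  by (cases t) auto

lemma sat_cong: "(\<And>x. x \<in> fv p \<Longrightarrow> e x = e' x) \<Longrightarrow> sat I e p \<longleftrightarrow> sat I e' p"
proof (induction p arbitrary: e e')
  case (Conc A t)
  then have "trm_val I e t = trm_val I e' t" by (intro trm_val_cong) auto
  then show ?case by simp
next
  case (Role R t u)
  then have "trm_val I e t = trm_val I e' t" "trm_val I e u = trm_val I e' u"
    by (auto intro!: trm_val_cong)
  then show ?case by simp
next
  case (Eq t u)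
  then have "trm_val I e t = trm_val I e' t" "trm_val I e u = trm_val I e' u"
    by (auto intro!: trm_val_cong)
  then show ?case by simp
next
  case (Neg p)
  have "sat I e p \<longleftrightarrow> sat I e' p" by (rule Neg.IH) (simp add: Neg.prems)
  then show ?case by simp
next
  case (Conj p q)
  have "sat I e p \<longleftrightarrow> sat I e' p" by (rule Conj.IH(1)) (simp add: Conj.prems)
  moreover have "sat I e q \<longleftrightarrow> sat I e' q" by (rule Conj.IH(2)) (simp add: Conj.prems)
  ultimately show ?case by simp
next
  case (Disj p q)
  have "sat I e p \<longleftrightarrow> sat I e' p" by (rule Disj.IH(1)) (simp add: Disj.prems)
  moreover have "sat I e q \<longleftrightarrow> sat I e' q" by (rule Disj.IH(2)) (simp add: Disj.prems)
  ultimately show ?case by simp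
next
  case (Ex x p)
  have "sat I (e(x := d)) p \<longleftrightarrow> sat I (e'(x := d)) p" for d
    by (rule Ex.IH) (simp add: Ex.prems)
  then show ?case by simp
next
  case (All x p)
  have "sat I (e(x := d)) p \<longleftrightarrow> sat I (e'(x := d)) p" for d
    by (rule All.IH) (simp add: All.prems)
  then show ?case by simp
qed simp

text \<open>Names for the elements of a Skolem hull: a formula to be witnessed, together with names for
  the values of its variables. They can be coded as formulas.\<close>

datatype ('c, 'r, 'i) skolem = Skolem "('c, 'r, 'i) fm" "('c, 'r, 'i) skolem list"

primrec skolem_code :: "('c, 'r, 'i) skolem \<Rightarrow> ('c, 'r, 'i) fm" where
  "skolem_code (Skolem p ts) = Conj p (foldr Conj (map skolem_code ts) Fls)"

lemma foldr_Conj_inj: "foldr Conj ps Fls = foldr Conj qs Fls \<Longrightarrow> ps = qs"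
proof (induction ps arbitrary: qs)
  case Nil
  then show ?case by (cases qs) simp_all
next
  case (Cons p ps)
  then show ?case by (cases qs) simp_all
qed

lemma skolem_code_inj: "skolem_code t = skolem_code u \<Longrightarrow> t = u"
proof (induction t arbitrary: u)
  case (Skolem p ts)
  obtain q us where u: "u = Skolem q us" by (cases u)
  have "p = q" and eq: "map skolem_code ts = map skolem_code us"
    using Skolem.prems unfolding u by (simp_all add: foldr_Conj_inj)
  have "ts = us"
  proof (rule nth_equalityI)
    show len: "length ts = length us" using eq by (rule map_eq_imp_length_eq)
    fix n assume n: "n < length ts"
    then have "skolem_code (ts ! n) = skolem_code (us ! n)"
      using eq len by (metis nth_map)
    then show "ts ! n = us ! n" using Skolem.IH n nth_mem by metis
  qed
  then show ?case using \<open>p = q\<close> u by simp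
qed

primrec skolem_val ::
    "('c, 'r, 'i, 'd) interp \<Rightarrow> (nat \<Rightarrow> 'd) \<Rightarrow> ('c, 'r, 'i) skolem \<Rightarrow> 'd" where
  "skolem_val I e0 (Skolem p ts) =
     (let vs = map (skolem_val I e0) ts; e = (\<lambda>n. if n < length vs then vs ! n else e0 0) in
      case p of
        Ex x q \<Rightarrow> (if \<exists>d\<in>univ I. sat I (e(x := d)) q
                   then SOME d. d \<in> univ I \<and> sat I (e(x := d)) q else e0 0)
      | Eq t u \<Rightarrow> trm_val I e0 t
      | _ \<Rightarrow> e0 0)"

lemma skolem_val_in_univ:
  assumes "is_interp I" "range e0 \<subseteq> univ I"
  shows "skolem_val I e0 t \<in> univ I"
proof (cases t)
  case (Skolem p ts)
  have 1: "e0 n \<in> univ I" for n using assms by auto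
  have 2: "trm_val I e0 u \<in> univ I" for u using assms 1 by (cases u) (auto simp: is_interp_def)
  have 3: "(SOME d. d \<in> univ I \<and> Q d) \<in> univ I" if "\<exists>d\<in>univ I. Q d" for Q
    using that by (metis (mono_tags, lifting) someI_ex)
  show ?thesis unfolding Skolem by (cases p) (simp_all add: Let_def 1 2 3)
qed

lemma skolem_hull_witness:
  assumes e: "range e \<subseteq> range (skolem_val I e0)"
    and d: "d \<in> univ I" "sat I (e(x := d)) p"
  shows "\<exists>d \<in> range (skolem_val I e0). d \<in> univ I \<and> sat I (e(x := d)) p"
proof -
  obtain N where N: "\<And>n. n \<in> fv p \<Longrightarrow> n < N"
    using finite_fv[of p] by (meson finite_nat_set_iff_bounded)
  have "\<exists>t. skolem_val I e0 t = e n" for n using e by (metis rangeE range_subsetD)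
  then obtain t where t: "\<And>n. skolem_val I e0 (t n) = e n" by metis
  define ts where "ts = map t [0..<N]"
  define vs where "vs = map (skolem_val I e0) ts"
  define e' where "e' = (\<lambda>n. if n < length vs then vs ! n else e0 0)"
  have "e' n = e n" if "n \<in> fv p" for n
    using N[OF that] by (simp add: e'_def vs_def ts_def t)
  then have eq: "sat I (e'(x := d)) p \<longleftrightarrow> sat I (e(x := d)) p" for d
    by (intro sat_cong) auto
  define w where "w = skolem_val I e0 (Skolem (Ex x p) ts)"
  have ex: "\<exists>d. d \<in> univ I \<and> sat I (e'(x := d)) p" using d eq by blast
  then have "w = (SOME d. d \<in> univ I \<and> sat I (e'(x := d)) p)"
    unfolding w_def skolem_val.simps Let_def vs_def[symmetric] e'_def[symmetric] by auto
  then have "w \<in> univ I \<and> sat I (e'(x := w)) p" using someI_ex[OF ex] by simp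
  then show ?thesis using eq w_def by blast
qed

lemma skolem_hull_sat:
  fixes I :: "('c, 'r, 'i, 'd) interp"
  assumes I: "is_interp I" and H: "H = range (skolem_val I e0)" and e0: "range e0 \<subseteq> univ I"
    and g: "bij_betw g S H"
    and J: "J = \<lparr>univ = S, conc_ext = (\<lambda>A. {s \<in> S. g s \<in> conc_ext I A}),
        role_ext = (\<lambda>R. {(s, t) \<in> S \<times> S. (g s, g t) \<in> role_ext I R}),
        const_val = (\<lambda>a. inv_into S g (const_val I a))\<rparr>"
    and c: "\<And>a. const_val I a \<in> H"
    and e: "range e \<subseteq> S"
  shows "sat J e p \<longleftrightarrow> sat I (g \<circ> e) p"
proof -
  have gS: "g s \<in> H" if "s \<in> S" for s using g that by (auto simp: bij_betw_def)
  have ginj: "g s = g t \<longleftrightarrow> s = t" if "s \<in> S" "t \<in> S" for s t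
    using g that by (auto simp: bij_betw_def inj_on_def)
  have gsurj: "\<exists>s\<in>S. g s = d" if "d \<in> H" for d using g that by (auto simp: bij_betw_def)
  have HI: "H \<subseteq> univ I" using skolem_val_in_univ[OF I e0] H by auto
  have gc: "g (inv_into S g (const_val I a)) = const_val I a" for a
    using g c by (simp add: bij_betw_def f_inv_into_f)
  have cS: "inv_into S g (const_val I a) \<in> S" for a
    using g c by (metis bij_betw_def inv_into_into)
  have tv: "trm_val J e t \<in> S" "g (trm_val J e t) = trm_val I (g \<circ> e) t"
    if "range e \<subseteq> S" for e t
    using that by (cases t; auto simp: J gc cS)+
  have upd: "range (e(x := s)) \<subseteq> S" if "range e \<subseteq> S" "s \<in> S" for e x s
    using that by auto
  have comp: "g \<circ> e(x := s) = (g \<circ> e)(x := g s)" for e x s by auto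
  have wit: "\<exists>s\<in>S. sat I ((g \<circ> e)(x := g s)) q"
    if "range e \<subseteq> S" "d \<in> univ I" "sat I ((g \<circ> e)(x := d)) q" for e x d q
  proof -
    have "range (g \<circ> e) \<subseteq> range (skolem_val I e0)" using that gS H by auto
    from skolem_hull_witness[OF this that(2,3)] H gsurj show ?thesis by metis
  qed
  have uJ: "univ J = S"
    and cJ: "\<And>A. conc_ext J A = {s \<in> S. g s \<in> conc_ext I A}"
    and rJ: "\<And>R. role_ext J R = {(s, t) \<in> S \<times> S. (g s, g t) \<in> role_ext I R}"
    by (simp_all add: J)
  show ?thesis using e
  proof (induction p arbitrary: e)
    case (Conc A t)
    show ?case
      unfolding sat.simps tv(2)[OF Conc.prems, symmetric] using tv(1)[OF Conc.prems]
      by (simp add: cJ)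
  next
    case (Role R t u)
    show ?case
      unfolding sat.simps tv(2)[OF Role.prems, symmetric] using tv(1)[OF Role.prems]
      by (simp add: rJ)
  next
    case (Eq t u)
    then show ?case
      unfolding sat.simps tv(2)[OF Eq.prems, symmetric] using tv(1)[OF Eq.prems] ginj by blast
  next
    case (Ex x p)
    have "sat J (e(x := s)) p \<longleftrightarrow> sat I ((g \<circ> e)(x := g s)) p" if "s \<in> S" for s
      using Ex.IH[OF upd[OF Ex.prems that]] by (simp only: comp)
    then have "sat J e (Ex x p) \<longleftrightarrow> (\<exists>s\<in>S. sat I ((g \<circ> e)(x := g s)) p)" by (simp add: uJ)
    also have "\<dots> \<longleftrightarrow> sat I (g \<circ> e) (Ex x p)"
      unfolding sat.simps using wit[OF Ex.prems] gS HI by blast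
    finally show ?case .
  next
    case (All x p)
    have "sat J (e(x := s)) p \<longleftrightarrow> sat I ((g \<circ> e)(x := g s)) p" if "s \<in> S" for s
      using All.IH[OF upd[OF All.prems that]] by (simp only: comp)
    then have "sat J e (All x p) \<longleftrightarrow> (\<forall>s\<in>S. sat I ((g \<circ> e)(x := g s)) p)" by (simp add: uJ)
    also have "\<dots> \<longleftrightarrow> sat I (g \<circ> e) (All x p)"
    proof -
      have "\<exists>s\<in>S. \<not> sat I ((g \<circ> e)(x := g s)) p"
        if "d \<in> univ I" "\<not> sat I ((g \<circ> e)(x := d)) p" for d
        using wit[OF All.prems, of d x "Neg p"] that by simp
      then show ?thesis unfolding sat.simps using gS HI by blast
    qed
    finally show ?case .
  next
    case Fls
    show ?case by simp
  next
    case (Neg p)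
    show ?case using Neg.IH[OF Neg.prems] by simp
  next
    case (Conj p q)
    show ?case using Conj.IH[OF Conj.prems] by simp
  next
    case (Disj p q)
    show ?case using Disj.IH[OF Disj.prems] by simp
  qed
qed

lemma loewenheim_skolem:
  fixes I :: "('c, 'r, 'i, 'd) interp"
  assumes I: "is_interp I" "models I \<Phi>" and e0: "range e0 \<subseteq> univ I"
  shows "\<exists>(J :: ('c, 'r, 'i) std_interp) e. is_interp J \<and> models J \<Phi> \<and> range e \<subseteq> univ J
           \<and> (\<forall>p. sat J e p \<longleftrightarrow> sat I e0 p)"
proof -
  define H where "H = range (skolem_val I e0)"
  define f where "f = (\<lambda>d. skolem_code (SOME t. skolem_val I e0 t = d))"
  have "inj_on f H"
  proof (rule inj_onI)
    fix d d' assume "d \<in> H" "d' \<in> H" and eq: "f d = f d'"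
    then have "\<exists>t. skolem_val I e0 t = d" "\<exists>t. skolem_val I e0 t = d'" by (auto simp: H_def)
    then have "skolem_val I e0 (SOME t. skolem_val I e0 t = d) = d"
      "skolem_val I e0 (SOME t. skolem_val I e0 t = d') = d'" by (auto intro: someI_ex)
    with eq skolem_code_inj show "d = d'" unfolding f_def by metis
  qed
  define S where "S = f ` H"
  define g where "g = inv_into H f"
  have g: "bij_betw g S H"
    using \<open>inj_on f H\<close> unfolding g_def S_def by (simp add: bij_betw_inv_into inj_on_imp_bij_betw)
  have e0H: "e0 n \<in> H" for n
  proof -
    have "skolem_val I e0 (Skolem (Eq (Var n) (Var n)) []) = e0 n" by simp
    then show ?thesis unfolding H_def by (metis rangeI)
  qed
  have HI: "H \<subseteq> univ I" using skolem_val_in_univ[OF I(1) e0] H_def by auto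
  have c: "const_val I a \<in> H" for a
  proof -
    have "skolem_val I e0 (Skolem (Eq (Const a) (Const a)) []) = const_val I a" by simp
    then show ?thesis unfolding H_def by (metis rangeI)
  qed
  define J :: "('c, 'r, 'i) std_interp" where
    "J = \<lparr>univ = S, conc_ext = (\<lambda>A. {s \<in> S. g s \<in> conc_ext I A}),
        role_ext = (\<lambda>R. {(s, t) \<in> S \<times> S. (g s, g t) \<in> role_ext I R}),
        const_val = (\<lambda>a. inv_into S g (const_val I a))\<rparr>"
  have sat: "sat J e p \<longleftrightarrow> sat I (g \<circ> e) p" if "range e \<subseteq> S" for e p
    by (rule skolem_hull_sat[OF I(1) H_def e0 g J_def c that])
  have "is_interp J"
  proof -
    have "inv_into S g (const_val I a) \<in> S" for a
      using g c by (metis bij_betw_def inv_into_into)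
    moreover have "S \<noteq> {}" using e0H by (auto simp: S_def)
    ultimately show ?thesis by (auto simp: is_interp_def J_def)
  qed
  moreover have "models J \<Phi>"
    unfolding models_def
  proof (intro ballI allI impI)
    fix p and e :: "nat \<Rightarrow> ('c, 'r, 'i) fm" assume p: "p \<in> \<Phi>" and "range e \<subseteq> univ J"
    then have e: "range e \<subseteq> S" by (simp add: J_def)
    then have "range (g \<circ> e) \<subseteq> univ I" using g HI by (auto simp: bij_betw_def)
    then show "sat J e p" using I p sat[OF e] by (simp add: models_def)
  qed
  moreover have "range (f \<circ> e0) \<subseteq> univ J" using e0H by (auto simp: J_def S_def)
  moreover have "sat J (f \<circ> e0) p \<longleftrightarrow> sat I e0 p" for p
  proof -
    have "g \<circ> (f \<circ> e0) = e0" using e0H \<open>inj_on f H\<close> by (auto simp: g_def)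
    moreover have "range (f \<circ> e0) \<subseteq> S" using e0H by (auto simp: S_def)
    ultimately show ?thesis using sat by metis
  qed
  ultimately show ?thesis by blast
qed

lemma entails_any_domain:
  fixes I :: "('c, 'r, 'i, 'd) interp"
  assumes "entails \<Phi> p" "is_interp I" "models I \<Phi>"
  shows "models I {p}"
proof -
  have "sat I e p" if "range e \<subseteq> univ I" for e
    using loewenheim_skolem[OF assms(2,3) that] assms(1)
    unfolding entails_def models_def by blast
  then show ?thesis by (simp add: models_def)
qed

lemma consistent_any_domain:
  fixes I :: "('c, 'r, 'i, 'd) interp"
  assumes "is_interp I" "models I \<Phi>"
  shows "consistent \<Phi>"
proof -
  obtain d where "d \<in> univ I" using assms by (auto simp: is_interp_def)
  then have "range (\<lambda>_. d) \<subseteq> univ I" by auto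
  from loewenheim_skolem[OF assms this] show ?thesis unfolding consistent_def by blast
qed

definition is_atom :: "('c, 'r, 'i) fm \<Rightarrow> bool" where
  "is_atom p \<longleftrightarrow> (\<exists>A t. p = Conc A t) \<or> (\<exists>R t u. p = Role R t u)"

definition is_fact :: "('c, 'r, 'i) fm \<Rightarrow> bool" where
  "is_fact p \<longleftrightarrow> is_atom p \<and> fv p = {}"

inductive is_conj_of_atoms :: "('c, 'r, 'i) fm \<Rightarrow> bool" where
  "is_atom p \<Longrightarrow> is_conj_of_atoms p"
| "is_conj_of_atoms p \<Longrightarrow> is_conj_of_atoms q \<Longrightarrow> is_conj_of_atoms (Conj p q)"

inductive is_cq :: "('c, 'r, 'i) fm \<Rightarrow> bool" where
  "is_cq Fls"
| "is_conj_of_atoms p \<Longrightarrow> is_cq (foldr Ex xs p)"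

inductive is_bucq :: "('c, 'r, 'i) fm \<Rightarrow> bool" where
  "is_cq p \<Longrightarrow> fv p = {} \<Longrightarrow> is_bucq p"
| "is_bucq p \<Longrightarrow> is_bucq q \<Longrightarrow> is_bucq (Disj p q)"

datatype ('c, 'r, 'i) ed = ED (body: "('c, 'r, 'i) fm") (head: "('c, 'r, 'i) fm")

text \<open>The universally quantified variables of an epistemic dependency are the free variables
  of its body; those of its head are among them.\<close>

definition is_ed :: "('c, 'r, 'i) ed \<Rightarrow> bool" where
  "is_ed \<tau> \<longleftrightarrow> is_cq (body \<tau>) \<and> is_cq (head \<tau>) \<and> fv (head \<tau>) \<subseteq> fv (body \<tau>)"

definition ground_subst_for :: "(nat \<rightharpoonup> 'i) \<Rightarrow> ('c, 'r, 'i) ed \<Rightarrow> bool" where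
  "ground_subst_for \<sigma> \<tau> \<longleftrightarrow> dom \<sigma> = fv (body \<tau>)"

definition ed_instance :: "(nat \<rightharpoonup> 'i) \<Rightarrow> ('c, 'r, 'i) ed \<Rightarrow> ('c, 'r, 'i) ed" where
  "ed_instance \<sigma> \<tau> = ED (subst \<sigma> (body \<tau>)) (subst \<sigma> (head \<tau>))"

definition satisfies_ed :: "('c, 'r, 'i) fm set \<Rightarrow> ('c, 'r, 'i) ed \<Rightarrow> bool" where
  "satisfies_ed \<Phi> \<tau> \<longleftrightarrow> (\<forall>\<sigma>. ground_subst_for \<sigma> \<tau> \<longrightarrow>
     entails \<Phi> (body (ed_instance \<sigma> \<tau>)) \<longrightarrow> entails \<Phi> (head (ed_instance \<sigma> \<tau>)))"

definition is_policy :: "('c, 'r, 'i) ed set \<Rightarrow> bool" where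
  "is_policy P \<longleftrightarrow> finite P \<and> (\<forall>\<tau>\<in>P. is_ed \<tau>)"

definition satisfies_policy :: "('c, 'r, 'i) fm set \<Rightarrow> ('c, 'r, 'i) ed set \<Rightarrow> bool" where
  "satisfies_policy \<Phi> P \<longleftrightarrow> (\<forall>\<tau>\<in>P. satisfies_ed \<Phi> \<tau>)"

text \<open>A Description Logic is given by the collection of its TBoxes. This covers logics whose TBoxes
  are all sets, or all finite sets, of axioms of a certain form, as well as logics that impose
  conditions on a TBox as a whole.\<close>

definition is_dl :: "('c, 'r, 'i) fm set set \<Rightarrow> bool" where
  "is_dl L \<longleftrightarrow> {} \<in> L \<and> (\<forall>T\<in>L. \<forall>p\<in>T. sentence p)"

record ('c, 'r, 'i) cqe =
  tbox :: "('c, 'r, 'i) fm set"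
  policy :: "('c, 'r, 'i) ed set"
  abox :: "('c, 'r, 'i) fm set"

definition cqe_instance :: "('c, 'r, 'i) fm set set \<Rightarrow> ('c, 'r, 'i) cqe \<Rightarrow> bool" where
  "cqe_instance L E \<longleftrightarrow> tbox E \<in> L \<and> is_policy (policy E) \<and> (\<forall>p\<in>abox E. is_fact p)
     \<and> consistent (tbox E \<union> abox E)"

definition cl :: "('c, 'r, 'i) fm set \<Rightarrow> ('c, 'r, 'i) fm set \<Rightarrow> ('c, 'r, 'i) fm set" where
  "cl T A = {p. is_fact p \<and> entails (T \<union> A) p}"

definition ga_censor :: "('c, 'r, 'i) cqe \<Rightarrow> ('c, 'r, 'i) fm set \<Rightarrow> bool" where
  "ga_censor E C \<longleftrightarrow> C \<subseteq> cl (tbox E) (abox E) \<and> satisfies_policy (tbox E \<union> C) (policy E)"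

definition optimal_ga_censor :: "('c, 'r, 'i) cqe \<Rightarrow> ('c, 'r, 'i) fm set \<Rightarrow> bool" where
  "optimal_ga_censor E C \<longleftrightarrow> ga_censor E C \<and> \<not> (\<exists>C'. C \<subset> C' \<and> ga_censor E C')"

definition iga_censor :: "('c, 'r, 'i) cqe \<Rightarrow> ('c, 'r, 'i) fm set" where
  "iga_censor E = \<Inter> {C. optimal_ga_censor E C}"

definition ga_entails :: "('c, 'r, 'i) cqe \<Rightarrow> ('c, 'r, 'i) fm \<Rightarrow> bool" where
  "ga_entails E q \<longleftrightarrow> (\<forall>C. optimal_ga_censor E C \<longrightarrow> entails (tbox E \<union> C) q)"

definition iga_entails :: "('c, 'r, 'i) cqe \<Rightarrow> ('c, 'r, 'i) fm \<Rightarrow> bool" where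
  "iga_entails E q \<longleftrightarrow> entails (tbox E \<union> iga_censor E) q"

definition indistinguishability ::
    "(('c, 'r, 'i) cqe \<Rightarrow> ('c, 'r, 'i) fm \<Rightarrow> bool) \<Rightarrow> ('c, 'r, 'i) fm set set
      \<Rightarrow> ('c, 'r, 'i) ed set set \<Rightarrow> bool" where
  "indistinguishability ent L Cp \<longleftrightarrow>
     (\<forall>E. cqe_instance L E \<longrightarrow> policy E \<in> Cp \<longrightarrow>
       (\<exists>A'. let E' = \<lparr>tbox = tbox E, policy = policy E, abox = A'\<rparr> in
         cqe_instance L E' \<and> satisfies_policy (tbox E \<union> A') (policy E)
         \<and> (\<forall>q. is_bucq q \<longrightarrow> (ent E q \<longleftrightarrow> ent E' q))))"

end

theory Submission imports Defs begin

text \<open>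
  With the empty TBox, take the ABox \<open>{A(a), R(a,a), R(b,b)}\<close> and the policy with the
  dependencies \<open>K(R(a,a) \<and> R(b,b)) \<rightarrow> K\<bottom>\<close> and \<open>K A(a) \<rightarrow> K \<exists>x. R(x,x)\<close>. The optimal censors are
  \<open>{A(a), R(a,a)}\<close> and \<open>{A(a), R(b,b)}\<close>. If an ABox \<open>A'\<close> satisfies the policy, then both kinds of
  entailment coincide with entailment from \<open>A'\<close>. Such an \<open>A'\<close> cannot have the same GA-consequences,
  because a set of facts that entails \<open>R(a,a) \<or> R(b,b)\<close> contains one of the disjuncts. It cannot have
  the same IGA-consequences either, because the intersection \<open>{A(a)}\<close> of the optimal censors
  violates the second dependency.
\<close>

section \<open>Closed dependencies, and censors of instances that satisfy their policy\<close>

lemma subst_trm_empty: "subst_trm Map.empty t = t"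
  by (cases t) auto

lemma subst_empty: "subst Map.empty p = p"
  by (induction p) (auto simp: subst_trm_empty fun_upd_idem)

text \<open>With a closed body the only ground substitution is the empty map, so a single instance
  has to be tested.\<close>

lemma satisfies_closed_ed:
  "fv (body \<tau>) = {} \<Longrightarrow> satisfies_ed \<Phi> \<tau> \<longleftrightarrow> (entails \<Phi> (body \<tau>) \<longrightarrow> entails \<Phi> (head \<tau>))"
  by (simp add: satisfies_ed_def ground_subst_for_def ed_instance_def subst_empty)

lemma models_Un: "models I (\<Phi> \<union> \<Psi>) \<longleftrightarrow> models I \<Phi> \<and> models I \<Psi>"
  by (auto simp: models_def)

lemma entails_member: "p \<in> \<Phi> \<Longrightarrow> entails \<Phi> p"
  by (auto simp: entails_def models_def)

text \<open>Both theories have the same models: the closure contains \<open>A\<close>, because facts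
  of \<open>A\<close> entail themselves, and adds only consequences of
  \<open>T \<union> A\<close>.\<close>

lemma entails_Un_cl:
  assumes "\<And>p. p \<in> A \<Longrightarrow> is_fact p"
  shows "entails (T \<union> cl T A) q \<longleftrightarrow> entails (T \<union> A) q"
proof -
  have "models I (T \<union> cl T A) \<longleftrightarrow> models I (T \<union> A)"
    if "is_interp I" for I :: "('a, 'b, 'c) std_interp"
  proof
    have "A \<subseteq> cl T A" using assms by (auto simp: cl_def intro: entails_member)
    then show "models I (T \<union> cl T A) \<Longrightarrow> models I (T \<union> A)" by (auto simp: models_def)
    show "models I (T \<union> A) \<Longrightarrow> models I (T \<union> cl T A)"
      using that unfolding models_Un by (auto simp: cl_def entails_def models_def)
  qed
  then show ?thesis unfolding entails_def by blast
qed

lemma satisfies_policy_cong: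
  "(\<And>q. entails \<Phi> q \<longleftrightarrow> entails \<Psi> q) \<Longrightarrow> satisfies_policy \<Phi> P \<longleftrightarrow> satisfies_policy \<Psi> P"
  by (simp add: satisfies_policy_def satisfies_ed_def)

text \<open>The closure is then itself a censor; since every censor lies inside it, it is the
  greatest one and hence the only optimal one.\<close>

lemma optimal_ga_censor_if_satisfies_policy:
  assumes "\<And>p. p \<in> abox E \<Longrightarrow> is_fact p"
    and "satisfies_policy (tbox E \<union> abox E) (policy E)"
  shows "optimal_ga_censor E C \<longleftrightarrow> C = cl (tbox E) (abox E)"
proof -
  have "satisfies_policy (tbox E \<union> cl (tbox E) (abox E)) (policy E)"
    using assms(2) satisfies_policy_cong[OF entails_Un_cl[OF assms(1)]] by blast
  then show ?thesis unfolding optimal_ga_censor_def ga_censor_def by blast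
qed

lemma censored_entails_if_satisfies_policy:
  assumes "\<And>p. p \<in> abox E \<Longrightarrow> is_fact p"
    and "satisfies_policy (tbox E \<union> abox E) (policy E)"
  shows "ga_entails E q \<longleftrightarrow> entails (tbox E \<union> abox E) q"
    and "iga_entails E q \<longleftrightarrow> entails (tbox E \<union> abox E) q"
  by (simp_all add: ga_entails_def iga_entails_def iga_censor_def
      optimal_ga_censor_if_satisfies_policy[OF assms] entails_Un_cl[OF assms(1)])

section \<open>The Herbrand model as canonical countermodel for sets of facts\<close>

definition herbrand :: "('c, 'r, 'i) fm set \<Rightarrow> ('c, 'r, 'i, 'i) interp" where
  "herbrand S = \<lparr>univ = UNIV, conc_ext = (\<lambda>A. {a. Conc A (Const a) \<in> S}),
     role_ext = (\<lambda>R. {(a, b). Role R (Const a) (Const b) \<in> S}), const_val = id\<rparr>"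

lemma is_interp_herbrand: "is_interp (herbrand S)"
  by (simp add: herbrand_def is_interp_def)

lemma fv_trm_empty: "fv_trm t = {} \<longleftrightarrow> (\<exists>a. t = Const a)"
  by (cases t) auto

lemma is_fact_iff:
  "is_fact p \<longleftrightarrow> (\<exists>A a. p = Conc A (Const a)) \<or> (\<exists>R a b. p = Role R (Const a) (Const b))"
  by (auto simp: is_fact_def is_atom_def fv_trm_empty)

lemma sat_herbrand_fact: "is_fact p \<Longrightarrow> sat (herbrand S) e p \<longleftrightarrow> p \<in> S"
  by (auto simp: is_fact_iff herbrand_def)

lemma models_herbrand:
  assumes "\<And>p. p \<in> S \<Longrightarrow> is_fact p"
  shows "models (herbrand S) S"
  using assms by (auto simp: models_def sat_herbrand_fact)

text \<open>The domain type here is \<open>'i\<close>, while \<open>entails\<close> speaks of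
  interpretations over formulas; \<open>entails_any_domain\<close> bridges the gap. No range
  condition on \<open>e\<close> arises because the domain is all of \<open>'i\<close>.\<close>

lemma entails_imp_sat_herbrand:
  assumes "\<And>p. p \<in> S \<Longrightarrow> is_fact p" and "entails S q"
  shows "sat (herbrand S) e q"
  using entails_any_domain[OF assms(2) is_interp_herbrand models_herbrand[OF assms(1)]]
  by (simp add: models_def herbrand_def)

lemma entails_fact_iff:
  assumes "\<And>p. p \<in> S \<Longrightarrow> is_fact p" and "is_fact q"
  shows "entails S q \<longleftrightarrow> q \<in> S"
  using entails_imp_sat_herbrand[OF assms(1)] sat_herbrand_fact[OF assms(2)] entails_member
  by blast

lemma entails_Conj: "entails \<Phi> (Conj p q) \<longleftrightarrow> entails \<Phi> p \<and> entails \<Phi> q"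
  by (auto simp: entails_def models_def)

text \<open>A set of facts cannot entail a disjunction of facts without containing a disjunct: the
  one Herbrand model must make some disjunct true, and it makes no fact outside \<open>S\<close>
  true.\<close>

lemma entails_Disj_fact_iff:
  assumes "\<And>p. p \<in> S \<Longrightarrow> is_fact p" and "is_fact q" "is_fact r"
  shows "entails S (Disj q r) \<longleftrightarrow> q \<in> S \<or> r \<in> S"
proof
  assume "entails S (Disj q r)"
  then have "sat (herbrand S) e (Disj q r)" for e by (rule entails_imp_sat_herbrand[OF assms(1), rotated])
  then show "q \<in> S \<or> r \<in> S" using assms by (simp add: sat_herbrand_fact)
qed (auto simp: entails_def models_def)

lemma not_entails_Fls:
  assumes "\<And>p. p \<in> S \<Longrightarrow> is_fact p"
  shows "\<not> entails S Fls"
  using entails_imp_sat_herbrand[OF assms] by fastforce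

text \<open>A witness in the Herbrand model is a constant, so it comes with a named loop in
  \<open>S\<close>.\<close>

lemma entails_loop_iff:
  fixes S :: "('c, 'r, 'i) fm set"
  assumes "\<And>p. p \<in> S \<Longrightarrow> is_fact p"
  shows "entails S (Ex x (Role R (Var x) (Var x))) \<longleftrightarrow> (\<exists>a. Role R (Const a) (Const a) \<in> S)"
proof
  assume "entails S (Ex x (Role R (Var x) (Var x)))"
  then have "sat (herbrand S) e (Ex x (Role R (Var x) (Var x)))" for e
    by (rule entails_imp_sat_herbrand[OF assms, rotated])
  then show "\<exists>a. Role R (Const a) (Const a) \<in> S" by (simp add: herbrand_def)
next
  assume "\<exists>a. Role R (Const a) (Const a) \<in> S"
  then obtain a where a: "Role R (Const a) (Const a) \<in> S" by blast
  show "entails S (Ex x (Role R (Var x) (Var x)))"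
    unfolding entails_def
  proof (intro allI impI)
    fix I :: "('c, 'r, 'i) std_interp"
    assume I: "is_interp I" "models I S"
    have c: "const_val I a \<in> univ I" using I(1) by (simp add: is_interp_def)
    then have "range (\<lambda>_::nat. const_val I a) \<subseteq> univ I" by auto
    with I(2) a have "sat I (\<lambda>_. const_val I a) (Role R (Const a) (Const a))"
      unfolding models_def by blast
    with c show "models I {Ex x (Role R (Var x) (Var x))}" by (auto simp: models_def)
  qed
qed

lemma cl_empty_TBox: "(\<And>p. p \<in> A \<Longrightarrow> is_fact p) \<Longrightarrow> cl {} A = A"
  by (auto simp: cl_def entails_fact_iff)

section \<open>Membership in the syntactic classes\<close>

lemma is_fact_simps:
  "is_fact (Conc A (Const a))" "is_fact (Role R (Const a) (Const b))"
  by (auto simp: is_fact_iff)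

lemma is_cq_if_conj_of_atoms: "is_conj_of_atoms p \<Longrightarrow> is_cq p"
  using is_cq.intros(2)[of p "[]"] by simp

lemma is_cq_loop: "is_cq (Ex x (Role R (Var x) (Var x)))"
proof -
  have "is_conj_of_atoms (Role R (Var x) (Var x))"
    by (rule is_conj_of_atoms.intros) (simp add: is_atom_def)
  then show ?thesis using is_cq.intros(2)[of _ "[x]"] by simp
qed

lemma is_conj_of_atoms_fact: "is_fact p \<Longrightarrow> is_conj_of_atoms p"
  by (simp add: is_fact_def is_conj_of_atoms.intros)

lemma is_bucq_fact: "is_fact p \<Longrightarrow> is_bucq p"
  by (intro is_bucq.intros(1) is_cq_if_conj_of_atoms is_conj_of_atoms_fact)
    (auto simp: is_fact_def)

section \<open>The counterexample\<close>

theorem proposition2: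
  fixes L :: "('c, 'r, 'i) fm set set"
  assumes "countable (UNIV :: 'i set)" and "infinite (UNIV :: 'i set)"
    and "is_dl L"
  shows "\<not> indistinguishability ga_entails L {P. is_policy P}
       \<and> \<not> indistinguishability iga_entails L {P. is_policy P}"
proof -
  obtain a b :: 'i where "a \<noteq> b"
    using assms(2) by (metis (full_types) UNIV_eq_I finite.emptyI finite_insert insertI1)
  \<comment> \<open>\<open>undefined\<close> serves as an arbitrary concept name, and below as an
    arbitrary role name: the types of names are only known to be nonempty.\<close>
  define A :: "('c, 'r, 'i) fm" where "A = Conc undefined (Const a)"
  define R :: "'i \<Rightarrow> ('c, 'r, 'i) fm" where "R = (\<lambda>c. Role undefined (Const c) (Const c))"
  define loop :: "('c, 'r, 'i) fm" where "loop = Ex 0 (Role undefined (Var 0) (Var 0))"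
  define P where "P = {ED (Conj (R a) (R b)) Fls, ED A loop}"
  define E where "E = \<lparr>tbox = {}, policy = P, abox = {A, R a, R b}\<rparr>"
  have fact: "is_fact A" "is_fact (R c)" for c
    by (simp_all add: A_def R_def is_fact_simps)
  have fv: "fv A = {}" "fv (R c) = {}" "fv loop = {}" for c
    by (simp_all add: A_def R_def loop_def)
  have neq: "A \<noteq> R c" "R a \<noteq> R b" for c using \<open>a \<noteq> b\<close> by (simp_all add: A_def R_def)
  have policy: "is_policy P"
    using fact by (simp add: is_policy_def P_def is_ed_def fv loop_def is_cq_loop is_cq.intros(1)
        is_cq_if_conj_of_atoms is_conj_of_atoms.intros(2) is_conj_of_atoms_fact)
  have loop: "entails S loop \<longleftrightarrow> (\<exists>c. R c \<in> S)"
    if "\<And>p. p \<in> S \<Longrightarrow> is_fact p" for S :: "('c, 'r, 'i) fm set"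
    unfolding loop_def R_def by (rule entails_loop_iff[OF that])
  \<comment> \<open>Both bodies are closed, and a set of facts never entails \<open>Fls\<close>, so
    satisfying the policy becomes a condition on membership in \<open>S\<close>.\<close>
  have sat: "satisfies_policy S P \<longleftrightarrow> \<not> (R a \<in> S \<and> R b \<in> S) \<and> (A \<in> S \<longrightarrow> (\<exists>c. R c \<in> S))"
    if S: "\<And>p. p \<in> S \<Longrightarrow> is_fact p" for S
    by (simp add: satisfies_policy_def P_def satisfies_closed_ed fv entails_Conj
        entails_fact_iff[OF S] fact not_entails_Fls[OF S] loop[OF S])
  have "consistent {A, R a, R b}"
    using fact by (intro consistent_any_domain[OF is_interp_herbrand models_herbrand]) auto
  then have inst: "cqe_instance L E"
    using assms(3) policy fact by (auto simp: cqe_instance_def is_dl_def E_def)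
  \<comment> \<open>The second dependency accepts a loop at any constant; inside the ABox only
    \<open>a\<close> and \<open>b\<close> remain.\<close>
  have Rin: "R c \<in> {A, R a, R b} \<Longrightarrow> c = a \<or> c = b" for c by (auto simp: A_def R_def)
  have clE: "cl {} {A, R a, R b} = {A, R a, R b}" using fact by (intro cl_empty_TBox) auto
  have censor: "ga_censor E C \<longleftrightarrow> C \<subseteq> {A, R a, R b} \<and> \<not> (R a \<in> C \<and> R b \<in> C)
      \<and> (A \<in> C \<longrightarrow> R a \<in> C \<or> R b \<in> C)" for C
  proof (cases "C \<subseteq> {A, R a, R b}")
    case True
    then have "\<And>p. p \<in> C \<Longrightarrow> is_fact p" using fact by auto
    from sat[OF this] True Rin show ?thesis unfolding ga_censor_def by (auto simp: E_def clE)
  qed (simp add: ga_censor_def E_def clE)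
  have opt: "optimal_ga_censor E C \<longleftrightarrow> C = {A, R a} \<or> C = {A, R b}" for C
  proof
    have cens: "ga_censor E {A, R a}" "ga_censor E {A, R b}" unfolding censor using neq by auto
    \<comment> \<open>A censor misses \<open>R a\<close> or \<open>R b\<close>, so it fits into one
      of the two candidates, which are censors themselves.\<close>
    have "C \<subseteq> {A, R a} \<or> C \<subseteq> {A, R b}" if "ga_censor E C" using that unfolding censor by blast
    then show "optimal_ga_censor E C \<Longrightarrow> C = {A, R a} \<or> C = {A, R b}"
      using cens unfolding optimal_ga_censor_def by blast
    \<comment> \<open>Once \<open>A\<close> is present, the first dependency forbids two loops and
      the second one forbids none.\<close>
    have max: "C' = {A, R a} \<or> C' = {A, R b}" if "ga_censor E C'" "A \<in> C'" for C'
      using that unfolding censor by blast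
    have incomparable: "\<not> {A, R a} \<subset> {A, R b}" "\<not> {A, R b} \<subset> {A, R a}"
      using neq(1)[symmetric] neq(2) by auto
    assume C: "C = {A, R a} \<or> C = {A, R b}"
    have False if "C \<subset> C'" "ga_censor E C'" for C'
    proof -
      have "A \<in> C'" using that C by auto
      from max[OF that(2) this] C that(1) incomparable show False by (elim disjE) simp_all
    qed
    with C cens show "optimal_ga_censor E C" unfolding optimal_ga_censor_def by metis
  qed
  have iga: "iga_censor E = {A}" unfolding iga_censor_def opt using neq(2) by auto
  have tboxE: "tbox E = {}" and policyE: "policy E = P" by (simp_all add: E_def)
  have opt_fact: "entails {A, R c} (R d) \<longleftrightarrow> R d \<in> {A, R c}" for c d
    by (rule entails_fact_iff) (use fact in auto)
  have opt_Disj: "entails {A, R c} (Disj (R a) (R b)) \<longleftrightarrow> R a \<in> {A, R c} \<or> R b \<in> {A, R c}" for c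
    by (rule entails_Disj_fact_iff) (use fact in auto)
  have "is_bucq loop" using is_bucq.intros(1)[OF _ fv(3)] by (simp add: loop_def is_cq_loop)
  then have bucq: "is_bucq A" "is_bucq (R c)" "is_bucq (Disj (R a) (R b))" "is_bucq loop" for c
    by (simp_all add: is_bucq_fact is_bucq.intros(2) fact)

  have ents: "ga_entails \<lparr>tbox = {}, policy = P, abox = A'\<rparr> q \<longleftrightarrow> entails A' q"
      "iga_entails \<lparr>tbox = {}, policy = P, abox = A'\<rparr> q \<longleftrightarrow> entails A' q"
    if "\<And>p. p \<in> A' \<Longrightarrow> is_fact p" "satisfies_policy A' P" for A' q
    using censored_entails_if_satisfies_policy[of "\<lparr>tbox = {}, policy = P, abox = A'\<rparr>"] that by simp_all

  \<comment> \<open>The argument shared by both relations: on ABoxes that satisfy the policy,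
    \<open>ent\<close> is plain entailment, so it remains to refute in \<open>no_abox\<close> that
    the facts of such an ABox entail exactly the answers of \<open>E\<close>.\<close>
  have counterexample: "\<not> indistinguishability ent L {P. is_policy P}"
    if ent: "\<And>A' q. (\<And>p. p \<in> A' \<Longrightarrow> is_fact p) \<Longrightarrow> satisfies_policy A' P \<Longrightarrow>
        ent \<lparr>tbox = {}, policy = P, abox = A'\<rparr> q \<longleftrightarrow> entails A' q"
      and no_abox: "\<And>A'. (\<And>p. p \<in> A' \<Longrightarrow> is_fact p) \<Longrightarrow> satisfies_policy A' P \<Longrightarrow>
        (\<And>q. is_bucq q \<Longrightarrow> ent E q \<longleftrightarrow> entails A' q) \<Longrightarrow> False" for ent
  proof
    assume "indistinguishability ent L {P. is_policy P}"
    from this[unfolded indistinguishability_def, rule_format, OF inst, unfolded tboxE policyE]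
    obtain A' where inst': "cqe_instance L \<lparr>tbox = {}, policy = P, abox = A'\<rparr>"
      and sat': "satisfies_policy A' P"
      and eq: "\<forall>q. is_bucq q \<longrightarrow> (ent E q \<longleftrightarrow> ent \<lparr>tbox = {}, policy = P, abox = A'\<rparr> q)"
      using policy by (auto simp: Let_def)
    have fact': "is_fact p" if "p \<in> A'" for p using inst' that by (simp add: cqe_instance_def)
    show False
    proof (rule no_abox[OF fact' sat'])
      show "ent E q \<longleftrightarrow> entails A' q" if "is_bucq q" for q
        using eq that ent[OF fact' sat'] by simp
    qed
  qed

  have "\<not> indistinguishability ga_entails L {P. is_policy P}"
  proof (rule counterexample)
    fix A' :: "('c, 'r, 'i) fm set"
    assume A': "\<And>p. p \<in> A' \<Longrightarrow> is_fact p"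
      and eq: "\<And>q. is_bucq q \<Longrightarrow> ga_entails E q \<longleftrightarrow> entails A' q"
    have ga: "ga_entails E q \<longleftrightarrow> entails {A, R a} q \<and> entails {A, R b} q" for q
      unfolding ga_entails_def opt by (auto simp: tboxE)
    have "ga_entails E (Disj (R a) (R b))"
      unfolding ga opt_Disj by simp
    then have "R a \<in> A' \<or> R b \<in> A'"
      using eq[OF bucq(3)] entails_Disj_fact_iff[OF A' fact(2) fact(2)] by simp
    \<comment> \<open>Each of the two facts is missing from the optimal censor that keeps the other
      one.\<close>
    moreover have "\<not> ga_entails E (R a)" "\<not> ga_entails E (R b)"
      unfolding ga opt_fact using neq(1)[symmetric] neq(2) by auto
    ultimately show False using eq[OF bucq(2)] entails_member by blast
  qed (rule ents(1))
  moreover have "\<not> indistinguishability iga_entails L {P. is_policy P}"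
  proof (rule counterexample)
    fix A' :: "('c, 'r, 'i) fm set"
    assume A': "\<And>p. p \<in> A' \<Longrightarrow> is_fact p" "satisfies_policy A' P"
      and eq: "\<And>q. is_bucq q \<Longrightarrow> iga_entails E q \<longleftrightarrow> entails A' q"
    have ent: "iga_entails E q \<longleftrightarrow> entails {A} q" for q by (simp add: iga_entails_def iga tboxE)
    have "A \<in> A'" using eq[OF bucq(1)] entails_fact_iff[OF A'(1) fact(1)]
      by (simp add: ent entails_member)
    \<comment> \<open>As \<open>A'\<close> contains \<open>A\<close> and satisfies the policy, it
      has a loop at some constant; \<open>eq\<close> carries \<open>loop\<close> back to
      \<open>{A}\<close>, which contains no role fact.\<close>
    then have "iga_entails E loop" using A'(2) loop[OF A'(1)] eq[OF bucq(4)] sat[OF A'(1)] by blast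
    then show False using loop[of "{A}"] fact(1) neq(1) by (auto simp: ent)
  qed (rule ents(2))
  ultimately show ?thesis by blast
qed

end
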